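(* Fix the clipping rule, noise multiplier, participation mechanism, number of rounds $T$, adjacency relation and privacy accountant used for the underlying privatized gradient-release mechanism. Suppose this accountant certifies that the sequence of privatized releases $(G_0,\dots,G_{T-1})$ satisfies $(\varepsilon,\delta)$-differential privacy. Then the full DP-FedSOFIM transcript \[ (\theta_1,M_0,H_0,\ \dots,\ \theta_T,M_{T-1},H_{T-1}) \] also satisfies $(\varepsilon,\delta)$-differential privacy.
   Context: A randomized mechanism $\mathcal M$ on datasets is $(\varepsilon,\delta)$-differentially private with respect to an adjacency relation if for all adjacent $\mathcal D,\mathcal D'$ and all measurable sets $S$, $\mathbb P[\mathcal M(\mathcal D)\in S]\le e^{\varepsilon}\,\mathbb P[\mathcal M(\mathcal D')\in S]+\delta$. "The accountant certifies" means that the sequence, as a randomized mechanism of the dataset, does satisfy this guarantee. DP-FedSOFIM: with fixed data-independent $\theta_0\in\mathbb R^d$, $M_{-1}=0\in\mathbb R^d$, $\beta\in[0,1)$, $\rho>0$ and stepsizes $\eta_t>0$, at each round $t=0,\dots,T-1$ the server receives a privatized (clipped and Gaussian-noised) aggregated gradient $G_t\in\mathbb R^d$, whose distribution depends on the dataset and on the current iterate $\theta_t$, and computes $M_t=\beta M_{t-1}+(1-\beta)G_t$, $H_t=(\rho I_d+M_tM_t^\top)^{-1}$, $\theta_{t+1}=\theta_t-\eta_tH_tG_t$. These server computations access the data only through $G_0,\dots,G_{T-1}$. *)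

theory Defs
  imports "HOL-Probability.Probability"
begin

(* A randomized mechanism is given by the family of its output laws, one probability measure
   on the outcome space N for each dataset. *)
definition differentially_private ::
    "'y measure \<Rightarrow> ('db \<Rightarrow> 'db \<Rightarrow> bool) \<Rightarrow> real \<Rightarrow> real \<Rightarrow> ('db \<Rightarrow> 'y measure) \<Rightarrow> bool" where
  "differentially_private N adj \<epsilon> \<delta> mech \<longleftrightarrow>
     (\<forall>D. mech D \<in> space (prob_algebra N)) \<and>
     (\<forall>D D'. adj D D' \<longrightarrow>
        (\<forall>S\<in>sets N. measure (mech D) S \<le> exp \<epsilon> * measure (mech D') S + \<delta>))"

(* (theta_{t+1}, M_t, H_t) *)
type_synonym 'n server_output = "(real^'n) \<times> (real^'n) \<times> (real^'n^'n)"

(* (G_t, (theta_{t+1}, M_t, H_t)) *)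
type_synonym 'n round = "(real^'n) \<times> 'n server_output"

definition preconditioner :: "real \<Rightarrow> real^'n \<Rightarrow> real^'n^'n" where
  "preconditioner \<rho> m = matrix_inv (mat \<rho> + (columnvector m :: real^1^'n) ** rowvector m)"

(* theta and m are theta_t and M_{t-1}; eta is the stepsize of this round. *)
definition server_step ::
    "real \<Rightarrow> real \<Rightarrow> real \<Rightarrow> real^'n \<Rightarrow> real^'n \<Rightarrow> real^'n \<Rightarrow> 'n server_output" where
  "server_step \<beta> \<rho> \<eta> \<theta> m g =
     (let m' = \<beta> *\<^sub>R m + (1 - \<beta>) *\<^sub>R g;
          H = preconditioner \<rho> m'
      in (\<theta> - \<eta> *\<^sub>R (H *v g), m', H))"

(* theta_t and M_{t-1}, read off the record h of the rounds 0, ..., t-1. *)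
definition current_iterate :: "real^'n \<Rightarrow> (nat \<Rightarrow> 'n round) \<Rightarrow> nat \<Rightarrow> real^'n" where
  "current_iterate \<theta>\<^sub>0 h t = (case t of 0 \<Rightarrow> \<theta>\<^sub>0 | Suc s \<Rightarrow> fst (snd (h s)))"

definition previous_momentum :: "(nat \<Rightarrow> 'n round) \<Rightarrow> nat \<Rightarrow> real^'n" where
  "previous_momentum h t = (case t of 0 \<Rightarrow> 0 | Suc s \<Rightarrow> fst (snd (snd (h s))))"

(* Sequences indexed by the rounds 0, ..., t-1. *)
abbreviation seq_space :: "nat \<Rightarrow> (nat \<Rightarrow> 'a::topological_space) measure" where
  "seq_space t \<equiv> Pi\<^sub>M {..<t} (\<lambda>_. borel)"

(* Joint law of the first t rounds. K s theta is the law of the privatized aggregate released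
   in round s when the current iterate is theta. *)
primrec rounds_law ::
    "real \<Rightarrow> real \<Rightarrow> (nat \<Rightarrow> real) \<Rightarrow> real^'n \<Rightarrow> (nat \<Rightarrow> real^'n \<Rightarrow> (real^'n) measure) \<Rightarrow> nat \<Rightarrow>
      (nat \<Rightarrow> 'n round) measure" where
  "rounds_law \<beta> \<rho> \<eta> \<theta>\<^sub>0 K 0 = return (seq_space 0) (\<lambda>_. undefined)"
| "rounds_law \<beta> \<rho> \<eta> \<theta>\<^sub>0 K (Suc t) =
     rounds_law \<beta> \<rho> \<eta> \<theta>\<^sub>0 K t \<bind>
       (\<lambda>h. distr (K t (current_iterate \<theta>\<^sub>0 h t)) (seq_space (Suc t))
         (\<lambda>g. h(t := (g, server_step \<beta> \<rho> (\<eta> t)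
                            (current_iterate \<theta>\<^sub>0 h t) (previous_momentum h t) g))))"

(* The privatized gradient-release mechanism consists of
     - particip D: the law of the participation pattern w of the whole run, so that participation may
       be correlated across rounds; w is not published;
     - release D t w theta: the law of G_t for the dataset D, given the participation pattern w
       and the current iterate theta_t = theta (sampling, clipping, aggregation and noise). *)
definition fedsofim_law ::
    "real \<Rightarrow> real \<Rightarrow> (nat \<Rightarrow> real) \<Rightarrow> real^'n \<Rightarrow> ('db \<Rightarrow> 'w measure) \<Rightarrow>
      ('db \<Rightarrow> nat \<Rightarrow> 'w \<Rightarrow> real^'n \<Rightarrow> (real^'n) measure) \<Rightarrow> nat \<Rightarrow> 'db \<Rightarrow> (nat \<Rightarrow> 'n round) measure"
  where
  "fedsofim_law \<beta> \<rho> \<eta> \<theta>\<^sub>0 particip release T D =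
     particip D \<bind> (\<lambda>w. rounds_law \<beta> \<rho> \<eta> \<theta>\<^sub>0 (\<lambda>t. release D t w) T)"

(* The law of (G_0, ..., G_{T-1}). *)
definition releases_mechanism ::
    "real \<Rightarrow> real \<Rightarrow> (nat \<Rightarrow> real) \<Rightarrow> real^'n \<Rightarrow> ('db \<Rightarrow> 'w measure) \<Rightarrow>
      ('db \<Rightarrow> nat \<Rightarrow> 'w \<Rightarrow> real^'n \<Rightarrow> (real^'n) measure) \<Rightarrow> nat \<Rightarrow> 'db \<Rightarrow> (nat \<Rightarrow> real^'n) measure"
  where
  "releases_mechanism \<beta> \<rho> \<eta> \<theta>\<^sub>0 particip release T D =
     distr (fedsofim_law \<beta> \<rho> \<eta> \<theta>\<^sub>0 particip release T D) (seq_space T) (\<lambda>h. \<lambda>t\<in>{..<T}. fst (h t))"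

(* The law of (theta_1, M_0, H_0, ..., theta_T, M_{T-1}, H_{T-1}). *)
definition transcript_mechanism ::
    "real \<Rightarrow> real \<Rightarrow> (nat \<Rightarrow> real) \<Rightarrow> real^'n \<Rightarrow> ('db \<Rightarrow> 'w measure) \<Rightarrow>
      ('db \<Rightarrow> nat \<Rightarrow> 'w \<Rightarrow> real^'n \<Rightarrow> (real^'n) measure) \<Rightarrow> nat \<Rightarrow> 'db \<Rightarrow>
      (nat \<Rightarrow> 'n server_output) measure" where
  "transcript_mechanism \<beta> \<rho> \<eta> \<theta>\<^sub>0 particip release T D =
     distr (fedsofim_law \<beta> \<rho> \<eta> \<theta>\<^sub>0 particip release T D) (seq_space T) (\<lambda>h. \<lambda>t\<in>{..<T}. snd (h t))"

end

theory Submission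
  imports Defs
begin

text \<open>
  The server outputs of the first \<open>T\<close> rounds are a measurable function of the releases
  \<open>G\<^sub>0, \<dots>, G\<^bsub>T-1\<^esub>\<close>, so the claim is closure of differential privacy under post-processing.
  Measurability rests on the Sherman--Morrison formula, by which the preconditioner is a continuous
  function of the momentum. That the joint law is carried by the graph of the post-processing map is
  expressed as invariance of the law under replaying the server on the recorded releases.
\<close>

section \<open>Post-processing of differentially private mechanisms\<close>

lemma differentially_private_distr:
  assumes "differentially_private N adj \<epsilon> \<delta> mech" and f: "f \<in> N \<rightarrow>\<^sub>M N'"
  shows "differentially_private N' adj \<epsilon> \<delta> (\<lambda>D. distr (mech D) N' f)"
proof -
  have mech: "mech D \<in> space (prob_algebra N)" for D
    using assms(1) by (simp add: differentially_private_def)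
  then have sets: "sets (mech D) = sets N" for D
    by (simp add: space_prob_algebra)
  have f': "f \<in> mech D \<rightarrow>\<^sub>M N'" for D
    using f by (simp add: measurable_cong_sets[OF sets refl])
  have "distr (mech D) N' f \<in> space (prob_algebra N')" for D
    using mech[of D] f' by (auto simp: space_prob_algebra intro: prob_space.prob_space_distr)
  moreover have "measure (distr (mech D) N' f) S \<le> exp \<epsilon> * measure (distr (mech D') N' f) S + \<delta>"
    if "adj D D'" "S \<in> sets N'" for D D' S
  proof -
    have space: "space (mech D) = space N" for D
      by (rule sets_eq_imp_space_eq[OF sets])
    \<comment> \<open>The two probabilities of \<open>S\<close> under the image laws are those of
      this one preimage under \<open>mech D\<close> and \<open>mech D'\<close>, so the guarantee for
      it carries over with the same \<epsilon> and \<delta>.\<close>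
    have "f -` S \<inter> space N \<in> sets N"
      using f that(2) by (rule measurable_sets)
    with assms(1) that(1) show ?thesis
      by (simp add: measure_distr[OF f' that(2)] space differentially_private_def)
  qed
  ultimately show ?thesis
    by (simp add: differentially_private_def)
qed

section \<open>Continuity and measurability of the server computations\<close>

lemma preconditioner_eq:
  fixes m :: "real^'n"
  assumes "\<rho> > 0"
  shows "preconditioner \<rho> m =
    (\<chi> i j. ((if i = j then 1 else 0) - m $ i * m $ j / (\<rho> + m \<bullet> m)) / \<rho>)"
proof -
  define s where "s = \<rho> + m \<bullet> m"
  define A where "A = mat \<rho> + (columnvector m :: real^1^'n) ** rowvector m"
  \<comment> \<open>The Sherman--Morrison candidate: the identity minus \<open>m\<close> times its
    transpose over \<open>s\<close>, all divided by \<rho>.\<close>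
  define B :: "real^'n^'n" where "B = (\<chi> i j. ((if i = j then 1 else 0) - m $ i * m $ j / s) / \<rho>)"
  have s: "s > 0" "m \<bullet> m = s - \<rho>"
    using assms by (simp_all add: s_def add_pos_nonneg)
  have A: "A $ i $ k = (if i = k then \<rho> else 0) + m $ i * m $ k" for i k
    by (simp add: A_def mat_def columnvector_def rowvector_def matrix_matrix_mult_def)
  have B: "B $ i $ j = ((if i = j then 1 else 0) - m $ i * m $ j / s) / \<rho>" for i j
    by (simp add: B_def)
  have "(A ** B) $ i $ j = mat 1 $ i $ j" for i j
  proof -
    \<comment> \<open>In \<open>A $ i $ k * B $ k $ j\<close> the product of the two rank-one parts
      is \<open>- c * (m $ k * m $ k)\<close>. Summed over \<open>k\<close> it gives
      \<open>- c * (m \<bullet> m)\<close>, and writing \<open>m \<bullet> m\<close> as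
      \<open>s - \<rho>\<close> makes the remaining terms cancel.\<close>
    define c where "c = m $ i * m $ j / (\<rho> * s)"
    have "(A ** B) $ i $ j = (\<Sum>k\<in>UNIV. A $ i $ k * B $ k $ j)"
      by (simp add: matrix_matrix_mult_def)
    also have "\<dots> = (\<Sum>k\<in>UNIV. (if i = k then \<rho> * B $ k $ j else 0)
        + ((if k = j then m $ i * m $ k / \<rho> else 0) - c * (m $ k * m $ k)))"
      using s(1) assms by (intro sum.cong refl) (auto simp: A B c_def field_simps)
    also have "\<dots> = \<rho> * B $ i $ j + (m $ i * m $ j / \<rho> - c * (m \<bullet> m))"
      by (simp add: sum.distrib sum_subtractf inner_vec_def flip: sum_distrib_left)
    also have "\<dots> = (if i = j then 1 else 0)"
      unfolding B s(2) c_def using s(1) assms by (simp add: field_simps)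
    finally show ?thesis by (simp add: mat_def)
  qed
  then have "A ** B = mat 1"
    by (simp add: vec_eq_iff)
  then have AB: "A ** B = mat 1 \<and> B ** A = mat 1"
    by (simp add: matrix_left_right_inverse)
  \<comment> \<open>\<open>matrix_inv\<close> is a choice among two-sided inverses. \<open>B\<close>
    shows that one exists, and uniqueness of inverses then identifies the chosen one with
    \<open>B\<close>.\<close>
  then have "A ** matrix_inv A = mat 1 \<and> matrix_inv A ** A = mat 1"
    unfolding matrix_inv_def by (rule someI)
  with AB have "matrix_inv A = B"
    by (metis matrix_mul_assoc matrix_mul_lid matrix_mul_rid)
  then show ?thesis
    by (simp add: preconditioner_def A_def B_def s_def)
qed

text \<open>By the closed form the entries of the preconditioner are rational in the momentum, with
  denominators bounded away from zero because \<rho> is positive. Continuity is joint in all three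
  arguments, since during a run the iterate, the momentum and the release are all random.\<close>

lemma continuous_server_step:
  fixes \<beta> \<rho> \<eta> :: real
  assumes "\<rho> > 0"
  shows "continuous_on UNIV (\<lambda>(\<theta>, m, g). server_step \<beta> \<rho> \<eta> \<theta> m (g :: real^'n))"
proof -
  have pos: "\<rho> + x \<bullet> x \<noteq> 0" for x :: "real^'n"
    using assms inner_ge_zero[of x] by linarith
  show ?thesis
    using assms
    by (auto simp: server_step_def Let_def preconditioner_eq matrix_vector_mult_def split_beta pos
        intro!: continuous_intros continuous_on_vec_lambda)
qed

lemma measurable_server_step:
  assumes "\<rho> > 0" "f \<in> borel_measurable M" "f' \<in> borel_measurable M"
    and "g \<in> borel_measurable M"
  shows "(\<lambda>x. server_step \<beta> \<rho> \<eta> (f x) (f' x) (g x :: real^'n)) \<in> borel_measurable M"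
proof -
  have "(\<lambda>x. (f x, f' x, g x)) \<in> borel_measurable M"
    using assms by (intro borel_measurable_Pair)
  from measurable_compose[OF this borel_measurable_continuous_onI[OF continuous_server_step[OF assms(1)]]]
  show ?thesis by simp
qed

text \<open>The records of a round carry the Borel sigma-algebra of a product type, not a product
  measure, so the projections are handled through continuity.\<close>

lemma measurable_fst_borel:
  "fst \<in> (borel :: ('a::second_countable_topology \<times> 'b::second_countable_topology) measure) \<rightarrow>\<^sub>M borel"
  by (intro borel_measurable_continuous_onI continuous_on_fst continuous_on_id)

lemma measurable_snd_borel:
  "snd \<in> (borel :: ('a::second_countable_topology \<times> 'b::second_countable_topology) measure) \<rightarrow>\<^sub>M borel"
  by (intro borel_measurable_continuous_onI continuous_on_snd continuous_on_id)

lemma measurable_current_iterate: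
  "(\<lambda>h. current_iterate \<theta>\<^sub>0 h t) \<in> borel_measurable (seq_space t :: (nat \<Rightarrow> 'n::finite round) measure)"
proof (cases t)
  case (Suc s)
  have "(\<lambda>h. h s) \<in> (seq_space t :: (nat \<Rightarrow> 'n round) measure) \<rightarrow>\<^sub>M borel"
    by (rule measurable_component_singleton) (simp add: Suc)
  then have "(\<lambda>h. fst (snd (h s))) \<in> (seq_space t :: (nat \<Rightarrow> 'n round) measure) \<rightarrow>\<^sub>M borel"
    by (intro measurable_compose[OF _ measurable_fst_borel] measurable_compose[OF _ measurable_snd_borel])
  then show ?thesis
    by (simp add: current_iterate_def Suc)
qed (simp add: current_iterate_def)

lemma measurable_previous_momentum:
  "(\<lambda>h. previous_momentum h t) \<in> borel_measurable (seq_space t :: (nat \<Rightarrow> 'n::finite round) measure)"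
proof (cases t)
  case (Suc s)
  have "(\<lambda>h. h s) \<in> (seq_space t :: (nat \<Rightarrow> 'n round) measure) \<rightarrow>\<^sub>M borel"
    by (rule measurable_component_singleton) (simp add: Suc)
  then have "(\<lambda>h. fst (snd (snd (h s)))) \<in> (seq_space t :: (nat \<Rightarrow> 'n round) measure) \<rightarrow>\<^sub>M borel"
    by (intro measurable_compose[OF _ measurable_fst_borel] measurable_compose[OF _ measurable_snd_borel])
  then show ?thesis
    by (simp add: previous_momentum_def Suc)
qed (simp add: previous_momentum_def)

section \<open>Replaying the server on recorded releases\<close>

definition append_round ::
    "real \<Rightarrow> real \<Rightarrow> (nat \<Rightarrow> real) \<Rightarrow> real^'n \<Rightarrow> nat \<Rightarrow> (nat \<Rightarrow> 'n round) \<Rightarrow> real^'n \<Rightarrow>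
      (nat \<Rightarrow> 'n round)" where
  "append_round \<beta> \<rho> \<eta> \<theta>\<^sub>0 t h g =
     h(t := (g, server_step \<beta> \<rho> (\<eta> t) (current_iterate \<theta>\<^sub>0 h t) (previous_momentum h t) g))"

text \<open>Separates the random part of a round, the draw of the release, from its deterministic
  part, which is the same map that drives \<open>replay\<close> below.\<close>

lemma rounds_law_Suc:
  "rounds_law \<beta> \<rho> \<eta> \<theta>\<^sub>0 K (Suc t) =
     rounds_law \<beta> \<rho> \<eta> \<theta>\<^sub>0 K t \<bind>
       (\<lambda>h. distr (K t (current_iterate \<theta>\<^sub>0 h t)) (seq_space (Suc t))
         (append_round \<beta> \<rho> \<eta> \<theta>\<^sub>0 t h))"
  by (simp add: append_round_def[abs_def])

text \<open>Neither the dataset nor the release kernels occur here: this is where the server's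
  access to the data through the releases alone becomes visible. The start \<open>undefined\<close>
  agrees with that of \<open>rounds_law\<close> and keeps the result extensional, as the points of
  \<open>seq_space t\<close> must be.\<close>

primrec replay ::
    "real \<Rightarrow> real \<Rightarrow> (nat \<Rightarrow> real) \<Rightarrow> real^'n \<Rightarrow> nat \<Rightarrow> (nat \<Rightarrow> real^'n) \<Rightarrow> (nat \<Rightarrow> 'n round)" where
  "replay \<beta> \<rho> \<eta> \<theta>\<^sub>0 0 G = (\<lambda>_. undefined)"
| "replay \<beta> \<rho> \<eta> \<theta>\<^sub>0 (Suc t) G = append_round \<beta> \<rho> \<eta> \<theta>\<^sub>0 t (replay \<beta> \<rho> \<eta> \<theta>\<^sub>0 t G) (G t)"

definition released :: "nat \<Rightarrow> (nat \<Rightarrow> 'n::finite round) \<Rightarrow> (nat \<Rightarrow> real^'n)" where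
  "released t h = (\<lambda>s\<in>{..<t}. fst (h s))"

lemma fst_replay: "s < t \<Longrightarrow> fst (replay \<beta> \<rho> \<eta> \<theta>\<^sub>0 t G s) = G s"
  by (induction t) (auto simp: append_round_def less_Suc_eq)

lemma replay_cong: "(\<And>s. s < t \<Longrightarrow> G s = G' s) \<Longrightarrow> replay \<beta> \<rho> \<eta> \<theta>\<^sub>0 t G = replay \<beta> \<rho> \<eta> \<theta>\<^sub>0 t G'"
  by (induction t) auto

text \<open>A replay of length \<open>t\<close> reads only the entries of \<open>G\<close> below
  \<open>t\<close>, and \<open>released t\<close> recovers exactly these. Replaying the recorded
  releases therefore acts as a projection onto the histories consistent with the server.\<close>

lemma replay_released_replay:
  "replay \<beta> \<rho> \<eta> \<theta>\<^sub>0 t (released t (replay \<beta> \<rho> \<eta> \<theta>\<^sub>0 t G)) = replay \<beta> \<rho> \<eta> \<theta>\<^sub>0 t G"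
  by (rule replay_cong) (simp add: released_def fst_replay)

text \<open>Consistency survives one more round. It is claimed for \<open>h'\<close> because an
  arbitrary history \<open>h\<close> may record server outputs that do not match its
  releases.\<close>

lemma replay_released_append_round:
  fixes h :: "nat \<Rightarrow> 'n::finite round" and \<theta>\<^sub>0 :: "real^'n"
    and \<beta> \<rho> :: real and \<eta> :: "nat \<Rightarrow> real" and t :: nat
  defines "h' \<equiv> replay \<beta> \<rho> \<eta> \<theta>\<^sub>0 t (released t h)"
  shows "replay \<beta> \<rho> \<eta> \<theta>\<^sub>0 (Suc t) (released (Suc t) (append_round \<beta> \<rho> \<eta> \<theta>\<^sub>0 t h' g))
    = append_round \<beta> \<rho> \<eta> \<theta>\<^sub>0 t h' g"
proof -
  \<comment> \<open>Storing \<open>g\<close> at index \<open>t\<close> leaves the first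
    \<open>t\<close> rounds of the replay unchanged, so the extended history is itself a
    replay.\<close>
  have "append_round \<beta> \<rho> \<eta> \<theta>\<^sub>0 t h' g = replay \<beta> \<rho> \<eta> \<theta>\<^sub>0 (Suc t) ((released t h)(t := g))"
    using replay_cong[of t "(released t h)(t := g)" "released t h"] by (simp add: h'_def)
  then show ?thesis
    by (simp only: replay_released_replay)
qed

section \<open>Measurability of the replay and of the laws of the rounds\<close>

lemma measurable_append_round:
  fixes f :: "'a \<Rightarrow> nat \<Rightarrow> 'n::finite round"
  assumes "\<rho> > 0" and f: "f \<in> M \<rightarrow>\<^sub>M seq_space t" and g: "g \<in> borel_measurable M"
  shows "(\<lambda>x. append_round \<beta> \<rho> \<eta> \<theta>\<^sub>0 t (f x) (g x)) \<in> M \<rightarrow>\<^sub>M seq_space (Suc t)"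
  unfolding append_round_def
proof (rule measurable_fun_upd[OF _ f])
  show "{..<Suc t} = {..<t} \<union> {t}" by auto
  show "(\<lambda>x. (g x, server_step \<beta> \<rho> (\<eta> t) (current_iterate \<theta>\<^sub>0 (f x) t) (previous_momentum (f x) t) (g x)))
      \<in> borel_measurable M"
    by (intro borel_measurable_Pair measurable_server_step assms
        measurable_compose[OF f measurable_current_iterate]
        measurable_compose[OF f measurable_previous_momentum])
qed

text \<open>The source \<open>seq_space T\<close> stays fixed while \<open>t\<close> grows, so that
  the induction hypothesis applies to the same sequence \<open>G\<close>; the bound
  \<open>t \<le> T\<close> makes every release that is read a coordinate of it.\<close>

lemma measurable_replay:
  assumes "\<rho> > 0" "t \<le> T"
  shows "replay \<beta> \<rho> \<eta> \<theta>\<^sub>0 t \<in> seq_space T \<rightarrow>\<^sub>M (seq_space t :: (nat \<Rightarrow> 'n::finite round) measure)"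
  using assms(2)
proof (induction t)
  case 0
  \<comment> \<open>The empty product has the everywhere undefined function as its only
    point.\<close>
  show ?case by (simp add: space_PiM[of "{}"] cong: measurable_cong)
next
  case (Suc t)
  have "(\<lambda>G. append_round \<beta> \<rho> \<eta> \<theta>\<^sub>0 t (replay \<beta> \<rho> \<eta> \<theta>\<^sub>0 t G) (G t)) \<in> seq_space T \<rightarrow>\<^sub>M seq_space (Suc t)"
    using Suc by (intro measurable_append_round assms(1) measurable_component_singleton) auto
  then show ?case
    by (subst measurable_cong[where g = "\<lambda>G. append_round \<beta> \<rho> \<eta> \<theta>\<^sub>0 t (replay \<beta> \<rho> \<eta> \<theta>\<^sub>0 t G) (G t)"]) simp_all
qed

lemma measurable_released:
  "released t \<in> (seq_space t :: (nat \<Rightarrow> 'n::finite round) measure) \<rightarrow>\<^sub>M seq_space t"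
  unfolding released_def
  by (intro measurable_restrict measurable_compose[OF _ measurable_fst_borel] measurable_component_singleton)

text \<open>Joint measurability serves two integrations: over the history \<open>h\<close>, from
  round to round, and over the hidden participation pattern \<open>w\<close>, once for the whole
  run.\<close>

lemma measurable_round_kernel:
  fixes K :: "nat \<Rightarrow> 'a \<Rightarrow> real^'n::finite \<Rightarrow> (real^'n) measure"
  assumes "\<rho> > 0" and K: "(\<lambda>(w, \<theta>). K t w \<theta>) \<in> W \<Otimes>\<^sub>M borel \<rightarrow>\<^sub>M prob_algebra borel"
  shows "(\<lambda>(w, h). distr (K t w (current_iterate \<theta>\<^sub>0 h t)) (seq_space (Suc t))
           (append_round \<beta> \<rho> \<eta> \<theta>\<^sub>0 t h))
         \<in> W \<Otimes>\<^sub>M seq_space t \<rightarrow>\<^sub>M prob_algebra (seq_space (Suc t))"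
proof -
  let ?N = "W \<Otimes>\<^sub>M (seq_space t :: (nat \<Rightarrow> 'n round) measure)"
  have "(\<lambda>x. (fst x, current_iterate \<theta>\<^sub>0 (snd x) t)) \<in> ?N \<rightarrow>\<^sub>M W \<Otimes>\<^sub>M borel"
    by (intro measurable_Pair measurable_fst measurable_compose[OF measurable_snd measurable_current_iterate])
  from measurable_compose[OF this K]
  have K': "(\<lambda>x. K t (fst x) (current_iterate \<theta>\<^sub>0 (snd x) t)) \<in> ?N \<rightarrow>\<^sub>M prob_algebra borel"
    by simp
  have "(\<lambda>y. append_round \<beta> \<rho> \<eta> \<theta>\<^sub>0 t (snd (fst y)) (snd y)) \<in> ?N \<Otimes>\<^sub>M borel \<rightarrow>\<^sub>M seq_space (Suc t)"
    by (intro measurable_append_round assms(1) measurable_snd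
        measurable_compose[OF measurable_fst measurable_snd])
  then have "(\<lambda>(x, g). append_round \<beta> \<rho> \<eta> \<theta>\<^sub>0 t (snd x) g) \<in> ?N \<Otimes>\<^sub>M borel \<rightarrow>\<^sub>M seq_space (Suc t)"
    by (simp add: split_beta)
  from measurable_distr_prob_space2[OF K' this] show ?thesis
    by (simp add: split_beta)
qed

lemma measurable_rounds_law:
  fixes K :: "nat \<Rightarrow> 'a \<Rightarrow> real^'n::finite \<Rightarrow> (real^'n) measure"
  assumes "\<rho> > 0"
    and "\<And>s. s < t \<Longrightarrow> (\<lambda>(w, \<theta>). K s w \<theta>) \<in> W \<Otimes>\<^sub>M borel \<rightarrow>\<^sub>M prob_algebra borel"
  shows "(\<lambda>w. rounds_law \<beta> \<rho> \<eta> \<theta>\<^sub>0 (\<lambda>s. K s w) t) \<in> W \<rightarrow>\<^sub>M prob_algebra (seq_space t)"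
  using assms(2)
proof (induction t)
  case 0
  have "return (seq_space 0) (\<lambda>_. undefined) \<in> space (prob_algebra (seq_space 0))"
    by (auto simp: space_prob_algebra space_PiM intro!: prob_space_return)
  then show ?case by simp
next
  case (Suc t)
  show ?case
    unfolding rounds_law_Suc
    by (rule measurable_bind_prob_space2[OF _ measurable_round_kernel]) (use Suc assms(1) in auto)
qed

section \<open>Invariance of the law of the rounds under replay\<close>

lemma distr_bind_prob_algebra:
  assumes M: "M \<in> space (prob_algebra N)" and k: "k \<in> N \<rightarrow>\<^sub>M prob_algebra L"
    and f: "f \<in> L \<rightarrow>\<^sub>M L'"
  shows "distr (M \<bind> k) L' f = M \<bind> (\<lambda>x. distr (k x) L' f)"
proof (rule distr_bind[OF _ _ f])
  show "k \<in> M \<rightarrow>\<^sub>M subprob_algebra L"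
    using measurable_prob_algebraD[OF k] M
    by (simp add: space_prob_algebra cong: measurable_cong_sets)
  show "space M \<noteq> {}"
    using M by (auto simp: space_prob_algebra prob_space.not_empty)
qed

text \<open>By induction the history before round \<open>t\<close> may be replaced by its replay
  without changing its law. A round appended to a replayed history gives a replayed history again,
  which the projection fixes.\<close>

lemma distr_replay_rounds_law:
  fixes K :: "nat \<Rightarrow> 'a \<Rightarrow> real^'n::finite \<Rightarrow> (real^'n) measure"
  assumes "\<rho> > 0" and w: "w \<in> space W"
    and "\<And>s. s < t \<Longrightarrow> (\<lambda>(w, \<theta>). K s w \<theta>) \<in> W \<Otimes>\<^sub>M borel \<rightarrow>\<^sub>M prob_algebra borel"
  shows "distr (rounds_law \<beta> \<rho> \<eta> \<theta>\<^sub>0 (\<lambda>s. K s w) t) (seq_space t)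
      (\<lambda>h. replay \<beta> \<rho> \<eta> \<theta>\<^sub>0 t (released t h))
    = rounds_law \<beta> \<rho> \<eta> \<theta>\<^sub>0 (\<lambda>s. K s w) t"
  using assms(3)
proof (induction t)
  case 0
  show ?case
    by (simp add: distr_return space_PiM)
next
  case (Suc t)
  let ?P = "\<lambda>t h. replay \<beta> \<rho> \<eta> \<theta>\<^sub>0 t (released t h)"
  let ?R = "rounds_law \<beta> \<rho> \<eta> \<theta>\<^sub>0 (\<lambda>s. K s w)"
  let ?k = "\<lambda>h. distr (K t w (current_iterate \<theta>\<^sub>0 h t)) (seq_space (Suc t)) (append_round \<beta> \<rho> \<eta> \<theta>\<^sub>0 t h)"
  have P: "?P s \<in> (seq_space s :: (nat \<Rightarrow> 'n round) measure) \<rightarrow>\<^sub>M seq_space s" for s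
    by (rule measurable_compose[OF measurable_released measurable_replay[OF assms(1) order_refl]])
  have "(\<lambda>w. rounds_law \<beta> \<rho> \<eta> \<theta>\<^sub>0 (\<lambda>s. K s w) t) \<in> W \<rightarrow>\<^sub>M prob_algebra (seq_space t)"
    by (rule measurable_rounds_law[OF assms(1)]) (simp add: Suc.prems)
  from measurable_space[OF this w] have R: "?R t \<in> space (prob_algebra (seq_space t))" .
  have K: "(\<lambda>(w, \<theta>). K t w \<theta>) \<in> W \<Otimes>\<^sub>M borel \<rightarrow>\<^sub>M prob_algebra borel"
    by (rule Suc.prems) simp
  have k: "?k \<in> seq_space t \<rightarrow>\<^sub>M prob_algebra (seq_space (Suc t))"
    using measurable_compose[OF measurable_Pair1'[OF w] measurable_round_kernel[where K = K and t = t, OF assms(1) K]]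
    by simp
  note kP = measurable_compose[OF P k]
  \<comment> \<open>For a fixed replayed history the two image measures merge into one under a
    composed map, and that map is \<open>append_round\<close> itself by
    \<open>replay_released_append_round\<close>.\<close>
  have "distr (?k (?P t h)) (seq_space (Suc t)) (?P (Suc t)) = ?k (?P t h)"
    if h: "h \<in> space (seq_space t)" for h
  proof -
    have Ph: "?P t h \<in> space (seq_space t)"
      using P h by (rule measurable_space)
    have "K t w (current_iterate \<theta>\<^sub>0 (?P t h) t) \<in> space (prob_algebra borel)"
      using measurable_space[OF K, of "(w, current_iterate \<theta>\<^sub>0 (?P t h) t)"] w
      by (simp add: space_pair_measure)
    then have sets: "sets (K t w (current_iterate \<theta>\<^sub>0 (?P t h) t)) = sets borel"
      by (simp add: space_prob_algebra)
    have "append_round \<beta> \<rho> \<eta> \<theta>\<^sub>0 t (?P t h) \<in> borel \<rightarrow>\<^sub>M seq_space (Suc t)"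
      using Ph by (intro measurable_append_round assms(1)) auto
    then have "append_round \<beta> \<rho> \<eta> \<theta>\<^sub>0 t (?P t h) \<in> K t w (current_iterate \<theta>\<^sub>0 (?P t h) t) \<rightarrow>\<^sub>M seq_space (Suc t)"
      by (simp only: measurable_cong_sets[OF sets refl])
    then show ?thesis
      by (simp only: distr_distr[OF P] o_def replay_released_append_round)
  qed
  moreover have "space (?R t) = space (seq_space t)"
    using R by (auto simp: space_prob_algebra dest: sets_eq_imp_space_eq)
  ultimately have fixed: "?R t \<bind> (\<lambda>h. distr (?k (?P t h)) (seq_space (Suc t)) (?P (Suc t)))
      = ?R t \<bind> (\<lambda>h. ?k (?P t h))"
    by (intro bind_cong refl) auto
  \<comment> \<open>The induction hypothesis is read from right to left, to insert the projection;
    \<open>bind_distr\<close> then moves it into the argument of the kernel.\<close>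
  have "?R (Suc t) = distr (?R t) (seq_space t) (?P t) \<bind> ?k"
    unfolding rounds_law_Suc using Suc by simp
  also have "\<dots> = ?R t \<bind> (\<lambda>h. ?k (?P t h))"
  proof (rule bind_distr)
    show "?P t \<in> ?R t \<rightarrow>\<^sub>M seq_space t"
      using R P by (simp add: space_prob_algebra cong: measurable_cong_sets)
    show "?k \<in> seq_space t \<rightarrow>\<^sub>M subprob_algebra (seq_space (Suc t))"
      using k by (rule measurable_prob_algebraD)
    show "space (?R t) \<noteq> {}"
      using R by (auto simp: space_prob_algebra prob_space.not_empty)
  qed
  finally have eq: "?R (Suc t) = ?R t \<bind> (\<lambda>h. ?k (?P t h))" .
  show ?case
    unfolding eq distr_bind_prob_algebra[OF R kP P] by (rule fixed)
qed

section \<open>Mixing over participation, and the transcript as an image of the releases\<close>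

lemma fedsofim_law_in_prob_algebra:
  fixes release :: "'db \<Rightarrow> nat \<Rightarrow> 'w \<Rightarrow> real^'n::finite \<Rightarrow> (real^'n) measure"
  assumes "\<rho> > 0" and "particip D \<in> space (prob_algebra W)"
    and "\<And>t. t < T \<Longrightarrow> (\<lambda>(w, \<theta>). release D t w \<theta>) \<in> W \<Otimes>\<^sub>M borel \<rightarrow>\<^sub>M prob_algebra borel"
  shows "fedsofim_law \<beta> \<rho> \<eta> \<theta>\<^sub>0 particip release T D \<in> space (prob_algebra (seq_space T))"
proof -
  have "(\<lambda>w. rounds_law \<beta> \<rho> \<eta> \<theta>\<^sub>0 (\<lambda>t. release D t w) T) \<in> W \<rightarrow>\<^sub>M prob_algebra (seq_space T)"
    by (rule measurable_rounds_law[OF assms(1,3)])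
  from sets_bind'[OF assms(2) this] prob_space_bind'[OF assms(2) this] show ?thesis
    by (simp add: fedsofim_law_def space_prob_algebra)
qed

text \<open>The replay map does not depend on \<open>w\<close>, so invariance given each
  participation pattern passes to the mixture: taking images commutes with
  \<open>bind\<close>.\<close>

lemma distr_replay_fedsofim_law:
  fixes release :: "'db \<Rightarrow> nat \<Rightarrow> 'w \<Rightarrow> real^'n::finite \<Rightarrow> (real^'n) measure"
  assumes "\<rho> > 0" and particip: "particip D \<in> space (prob_algebra W)"
    and release: "\<And>t. t < T \<Longrightarrow> (\<lambda>(w, \<theta>). release D t w \<theta>) \<in> W \<Otimes>\<^sub>M borel \<rightarrow>\<^sub>M prob_algebra borel"
  shows "distr (fedsofim_law \<beta> \<rho> \<eta> \<theta>\<^sub>0 particip release T D) (seq_space T)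
      (\<lambda>h. replay \<beta> \<rho> \<eta> \<theta>\<^sub>0 T (released T h)) =
    fedsofim_law \<beta> \<rho> \<eta> \<theta>\<^sub>0 particip release T D"
proof -
  let ?P = "\<lambda>h. replay \<beta> \<rho> \<eta> \<theta>\<^sub>0 T (released T h)"
  let ?R = "\<lambda>w. rounds_law \<beta> \<rho> \<eta> \<theta>\<^sub>0 (\<lambda>t. release D t w) T"
  have R: "?R \<in> W \<rightarrow>\<^sub>M prob_algebra (seq_space T)"
    by (rule measurable_rounds_law[OF assms(1) release])
  have P: "?P \<in> (seq_space T :: (nat \<Rightarrow> 'n round) measure) \<rightarrow>\<^sub>M seq_space T"
    by (rule measurable_compose[OF measurable_released measurable_replay[OF assms(1) order_refl]])
  have "distr (?R w) (seq_space T) ?P = ?R w" if "w \<in> space W" for w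
    by (rule distr_replay_rounds_law[OF assms(1) that release])
  moreover have "space (particip D) = space W"
    using particip by (auto simp: space_prob_algebra dest: sets_eq_imp_space_eq)
  ultimately show ?thesis
    unfolding fedsofim_law_def distr_bind_prob_algebra[OF particip R P]
    by (intro bind_cong refl) auto
qed

lemma transcript_mechanism_eq_distr:
  fixes release :: "'db \<Rightarrow> nat \<Rightarrow> 'w \<Rightarrow> real^'n::finite \<Rightarrow> (real^'n) measure"
  assumes "\<rho> > 0" and "particip D \<in> space (prob_algebra W)"
    and "\<And>t. t < T \<Longrightarrow> (\<lambda>(w, \<theta>). release D t w \<theta>) \<in> W \<Otimes>\<^sub>M borel \<rightarrow>\<^sub>M prob_algebra borel"
  shows "transcript_mechanism \<beta> \<rho> \<eta> \<theta>\<^sub>0 particip release T D =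
    distr (releases_mechanism \<beta> \<rho> \<eta> \<theta>\<^sub>0 particip release T D) (seq_space T)
      (\<lambda>G. \<lambda>t\<in>{..<T}. snd (replay \<beta> \<rho> \<eta> \<theta>\<^sub>0 T G t))"
proof -
  let ?L = "fedsofim_law \<beta> \<rho> \<eta> \<theta>\<^sub>0 particip release T D"
  let ?snd = "\<lambda>h :: nat \<Rightarrow> 'n round. \<lambda>t\<in>{..<T}. snd (h t)"
  have "sets ?L = sets (seq_space T)"
    using fedsofim_law_in_prob_algebra[where particip = particip and release = release and D = D and T = T,
        OF assms]
    by (simp add: space_prob_algebra)
  note L = measurable_cong_sets[OF this refl]
  have snd: "?snd \<in> seq_space T \<rightarrow>\<^sub>M seq_space T"
    by (intro measurable_restrict measurable_compose[OF _ measurable_snd_borel] measurable_component_singleton)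
  note replay = measurable_replay[OF assms(1) order_refl, of \<beta> \<eta> \<theta>\<^sub>0 T]
  \<comment> \<open>Reading the server outputs off a history does not factor through its releases.
    It does after the replay is inserted, and invariance allows this; the rest regroups the
    composition of \<open>released\<close>, \<open>replay\<close> and \<open>?snd\<close>.\<close>
  have "transcript_mechanism \<beta> \<rho> \<eta> \<theta>\<^sub>0 particip release T D
      = distr (distr ?L (seq_space T) (\<lambda>h. replay \<beta> \<rho> \<eta> \<theta>\<^sub>0 T (released T h))) (seq_space T) ?snd"
    unfolding transcript_mechanism_def
    by (subst distr_replay_fedsofim_law[where particip = particip and release = release and D = D and T = T,
          OF assms]) simp_all
  also have "\<dots> = distr ?L (seq_space T) (\<lambda>h. ?snd (replay \<beta> \<rho> \<eta> \<theta>\<^sub>0 T (released T h)))"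
    using measurable_compose[OF measurable_released replay]
    by (subst distr_distr[OF snd]) (simp_all add: L o_def)
  also have "\<dots> = distr (distr ?L (seq_space T) (released T)) (seq_space T) (\<lambda>G. ?snd (replay \<beta> \<rho> \<eta> \<theta>\<^sub>0 T G))"
    using measurable_released
    by (subst distr_distr[OF measurable_compose[OF replay snd]]) (simp_all add: L o_def)
  also have "distr ?L (seq_space T) (released T) = releases_mechanism \<beta> \<rho> \<eta> \<theta>\<^sub>0 particip release T D"
    by (simp add: releases_mechanism_def released_def[abs_def])
  finally show ?thesis .
qed

theorem theorem4p38:
  fixes \<beta> \<rho> \<epsilon> \<delta> :: real
    and \<eta> :: "nat \<Rightarrow> real"
    and \<theta>\<^sub>0 :: "real^'n"
    and T :: nat
    and adj :: "'db \<Rightarrow> 'db \<Rightarrow> bool"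
    and W :: "'w measure"
    and particip :: "'db \<Rightarrow> 'w measure"
    and release :: "'db \<Rightarrow> nat \<Rightarrow> 'w \<Rightarrow> real^'n \<Rightarrow> (real^'n) measure"
  assumes "0 \<le> \<beta>" and "\<beta> < 1"
    and "\<rho> > 0"
    and "\<And>t. t < T \<Longrightarrow> \<eta> t > 0"
    and participation: "\<And>D. particip D \<in> space (prob_algebra W)"
    and release_kernel: "\<And>D t. t < T \<Longrightarrow>
          (\<lambda>(w, \<theta>). release D t w \<theta>) \<in> W \<Otimes>\<^sub>M borel \<rightarrow>\<^sub>M prob_algebra borel"
    and certified: "differentially_private (seq_space T) adj \<epsilon> \<delta>
          (releases_mechanism \<beta> \<rho> \<eta> \<theta>\<^sub>0 particip release T)"
  shows "differentially_private (seq_space T) adj \<epsilon> \<delta>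
          (transcript_mechanism \<beta> \<rho> \<eta> \<theta>\<^sub>0 particip release T)"
proof -
  \<comment> \<open>An equation between functions of the dataset: one and the same map of
    \<open>G\<close> serves every \<open>D\<close>, as post-processing requires.\<close>
  have "transcript_mechanism \<beta> \<rho> \<eta> \<theta>\<^sub>0 particip release T =
    (\<lambda>D. distr (releases_mechanism \<beta> \<rho> \<eta> \<theta>\<^sub>0 particip release T D) (seq_space T)
      (\<lambda>G. \<lambda>t\<in>{..<T}. snd (replay \<beta> \<rho> \<eta> \<theta>\<^sub>0 T G t)))"
    by (rule ext, rule transcript_mechanism_eq_distr[OF \<open>\<rho> > 0\<close>])
      (rule participation, rule release_kernel)
  moreover have "(\<lambda>G. \<lambda>t\<in>{..<T}. snd (replay \<beta> \<rho> \<eta> \<theta>\<^sub>0 T G t)) \<in> seq_space T \<rightarrow>\<^sub>M seq_space T"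
    by (intro measurable_restrict measurable_compose[OF _ measurable_snd_borel]
        measurable_compose[OF measurable_replay[OF \<open>\<rho> > 0\<close> order_refl] measurable_component_singleton])
  ultimately show ?thesis
    using differentially_private_distr[OF certified] by simp
qed

end
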